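(* Let $d\ge 3$, $G=\operatorname{SL}_d(\mathbb{R})$, $\Gamma=\operatorname{SL}_d(\mathbb{Z})$, $X=G/\Gamma$. Let $\mathcal{R}_d$ be the set of $\boldsymbol{\xi}=(\xi_1,\ldots,\xi_{d-1})\in[-\tfrac12,\tfrac12]^{d-1}$ such that $$\dim\operatorname{span}_{\mathbb{Q}}(1,\xi_1,\ldots,\xi_{d-1})\le 2 .$$ Then for every $\boldsymbol{\xi}\in\mathcal{R}_d$ the point $u(\boldsymbol{\xi})\Gamma\in X$ is $A^+$-divergent on average.
   Context: For $\boldsymbol{\xi}\in\mathbb{R}^{d-1}$ (a column vector), $u(\boldsymbol{\xi})=\begin{pmatrix}\operatorname{Id}_{d-1}&\boldsymbol{\xi}\\0&1\end{pmatrix}\in G$. For $\boldsymbol{\tau}=(\tau_1,\ldots,\tau_{d-1})\in\mathbb{R}^{d-1}$, $a_{\boldsymbol{\tau}}=\operatorname{diag}(e^{\tau_1},\ldots,e^{\tau_{d-1}},e^{-(\tau_1+\cdots+\tau_{d-1})})\in G$, and $A^+=\{a_{\boldsymbol{\tau}}:\tau_1,\ldots,\tau_{d-1}>0\}$. A point $x\in X$ is called $A^+$-divergent on average if for every compact set $K\subset X$, $$\lim_{N\to\infty}\frac{1}{N^{d-1}}\#\{\boldsymbol{\tau}\in\{1,\ldots,N\}^{d-1}:\ a_{\boldsymbol{\tau}}x\in K\}=0.$$ $\operatorname{span}_{\mathbb{Q}}$ is the $\mathbb{Q}$-linear span in $\mathbb{R}$ and $\dim$ its dimension over $\mathbb{Q}$.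 *)

theory Defs
  imports "HOL-Analysis.Analysis" "HOL-Algebra.Left_Coset"
begin

text \<open>
  With \<open>CARD('n) = d - 1\<close>, the index type of \<open>d\<times>d\<close> matrices is \<open>'n option\<close>: the elements
  \<open>Some i\<close> are the first \<open>d - 1\<close> indices and \<open>None\<close> is the last one.
\<close>

definition SL :: "(real ^ 'm ^ 'm) monoid" where
  "SL = \<lparr>carrier = {A. det A = 1}, mult = (**), one = mat 1\<rparr>"

definition SL_int :: "(real ^ 'm ^ 'm) set" where
  "SL_int = {A. det A = 1 \<and> (\<forall>i j. A $ i $ j \<in> \<int>)}"

definition quotient_space :: "(real ^ 'm ^ 'm) set topology" where
  "quotient_space = topology (\<lambda>U. U \<subseteq> lcosets\<^bsub>SL\<^esub> SL_int \<and>
     openin (top_of_set (carrier SL)) {g \<in> carrier SL. g <#\<^bsub>SL\<^esub> SL_int \<in> U})"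

lemma group_SL: "group (SL :: (real ^ 'm ^ 'm) monoid)"
proof (rule groupI)
  fix A :: "real ^ 'm ^ 'm"
  assume "A \<in> carrier SL"
  then have d: "det A = 1" by (simp add: SL_def)
  then obtain B where B: "A ** B = mat 1" "B ** A = mat 1"
    using invertible_det_nz[of A] by (auto simp: invertible_def)
  have "det B = 1" using arg_cong[OF B(1), of det] d by (simp add: det_mul)
  then show "\<exists>B\<in>carrier SL. B \<otimes>\<^bsub>SL\<^esub> A = \<one>\<^bsub>SL\<^esub>"
    using B by (auto simp: SL_def)
qed (auto simp: SL_def det_mul matrix_mul_assoc)

lemma det_in_Ints:
  fixes A :: "real ^ 'm ^ 'm"
  assumes "\<And>i j. A $ i $ j \<in> \<int>"
  shows "det A \<in> \<int>"
  unfolding det_def using assms by (auto intro!: Ints_sum Ints_mult Ints_prod)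

lemma subgroup_SL_int: "subgroup SL_int (SL :: (real ^ 'm ^ 'm) monoid)"
proof -
  interpret group "SL :: (real ^ 'm ^ 'm) monoid" by (rule group_SL)
  show ?thesis
  proof (rule subgroupI)
    show "SL_int \<noteq> ({} :: (real ^ 'm ^ 'm) set)"
    proof -
      have "mat 1 \<in> (SL_int :: (real ^ 'm ^ 'm) set)" by (auto simp: SL_int_def mat_def det_I[unfolded mat_def])
      then show ?thesis by blast
    qed
  next
    fix A :: "real ^ 'm ^ 'm" assume A: "A \<in> SL_int"
    then have Ac: "A \<in> carrier SL" and d: "det A = 1" by (auto simp: SL_int_def SL_def)
    define B where "B = inv\<^bsub>SL\<^esub> A"
    have Bc: "B \<in> carrier SL" and AB: "A ** B = mat 1"
      using r_inv[OF Ac] inv_closed[OF Ac] by (auto simp: B_def SL_def)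
    have "B $ k $ j \<in> \<int>" for k j
    proof -
      let ?x = "\<chi> i. B $ i $ j"
      have x: "A *v ?x = axis j 1"
        using AB by (simp add: vec_eq_iff matrix_matrix_mult_def matrix_vector_mult_def mat_def axis_def)
      have "?x $ k = det (\<chi> i l. if l = k then (axis j 1 :: real ^ 'm) $ i else A $ i $ l) / det A"
        using cramer[of A ?x "axis j 1"] d x by simp
      also have "\<dots> \<in> \<int>"
        using A d by (auto intro!: det_in_Ints simp: SL_int_def axis_def)
      finally show ?thesis by simp
    qed
    then show "inv\<^bsub>SL\<^esub> A \<in> SL_int"
      using Bc by (auto simp: B_def SL_int_def SL_def)
  next
    fix A B :: "real ^ 'm ^ 'm" assume "A \<in> SL_int" "B \<in> SL_int"
    then show "A \<otimes>\<^bsub>SL\<^esub> B \<in> SL_int"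
      using det_mul[of A B]
      by (auto simp: SL_int_def SL_def matrix_matrix_mult_def intro!: Ints_sum Ints_mult)
  qed (auto simp: SL_int_def SL_def)
qed

lemma openin_quotient_space:
  fixes U :: "(real ^ 'm ^ 'm) set set"
  shows "openin quotient_space U \<longleftrightarrow> U \<subseteq> lcosets\<^bsub>SL\<^esub> SL_int \<and>
     openin (top_of_set (carrier SL)) {g \<in> carrier SL. g <#\<^bsub>SL\<^esub> SL_int \<in> U}"
proof -
  have "istopology (\<lambda>U :: (real ^ 'm ^ 'm) set set. U \<subseteq> lcosets\<^bsub>SL\<^esub> SL_int \<and>
     openin (top_of_set (carrier SL)) {g \<in> carrier SL. g <#\<^bsub>SL\<^esub> SL_int \<in> U})"
    (is "istopology ?P")
    unfolding istopology_def
  proof (intro conjI allI impI)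
    fix S T :: "(real ^ 'm ^ 'm) set set" assume ST: "?P S" "?P T"
    have "{g \<in> carrier SL. g <#\<^bsub>SL\<^esub> SL_int \<in> S \<inter> T} =
        {g \<in> carrier SL. g <#\<^bsub>SL\<^esub> SL_int \<in> S} \<inter> {g \<in> carrier SL. g <#\<^bsub>SL\<^esub> SL_int \<in> T}"
      by blast
    then show "openin (top_of_set (carrier SL)) {g \<in> carrier SL. g <#\<^bsub>SL\<^esub> SL_int \<in> S \<inter> T}"
      using ST by (simp add: openin_Int)
    show "S \<inter> T \<subseteq> lcosets\<^bsub>SL\<^esub> SL_int" using ST by blast
  next
    fix \<K> :: "(real ^ 'm ^ 'm) set set set" assume K: "\<forall>S\<in>\<K>. ?P S"
    have "{g \<in> carrier SL. g <#\<^bsub>SL\<^esub> SL_int \<in> \<Union>\<K>} =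
        \<Union>((\<lambda>S. {g \<in> carrier SL. g <#\<^bsub>SL\<^esub> SL_int \<in> S}) ` \<K>)"
      by blast
    moreover have "openin (top_of_set (carrier SL)) \<dots>"
      using K by (intro openin_Union) auto
    ultimately show "openin (top_of_set (carrier SL)) {g \<in> carrier SL. g <#\<^bsub>SL\<^esub> SL_int \<in> \<Union>\<K>}"
      by simp
    show "\<Union>\<K> \<subseteq> lcosets\<^bsub>SL\<^esub> SL_int" using K by blast
  qed
  then show ?thesis by (simp add: quotient_space_def)
qed

lemma topspace_quotient_space:
  "topspace quotient_space = (lcosets\<^bsub>SL\<^esub> SL_int :: (real ^ 'm ^ 'm) set set)"
proof
  show "topspace quotient_space \<subseteq> (lcosets\<^bsub>SL\<^esub> SL_int :: (real ^ 'm ^ 'm) set set)"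
    using openin_topspace[of quotient_space] unfolding openin_quotient_space by blast
  have "{g \<in> carrier SL. g <#\<^bsub>SL\<^esub> SL_int \<in> lcosets\<^bsub>SL\<^esub> SL_int} = (carrier SL :: (real ^ 'm ^ 'm) set)"
    by (auto simp: LCOSETS_def)
  then have "openin quotient_space (lcosets\<^bsub>SL\<^esub> SL_int :: (real ^ 'm ^ 'm) set set)"
    unfolding openin_quotient_space by simp
  then show "(lcosets\<^bsub>SL\<^esub> SL_int :: (real ^ 'm ^ 'm) set set) \<subseteq> topspace quotient_space"
    by (rule openin_subset)
qed

lemma quotient_map_quotient_space:
  "quotient_map (top_of_set (carrier SL)) quotient_space (\<lambda>g. g <#\<^bsub>SL\<^esub> SL_int)"
  unfolding quotient_map_def topspace_quotient_space
  by (auto simp: openin_quotient_space LCOSETS_def)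


definition u_mat :: "real ^ 'n \<Rightarrow> real ^ ('n::finite) option ^ 'n option" where
  "u_mat \<xi> = (\<chi> i j. if i = j then 1
     else (case (i, j) of (Some k, None) \<Rightarrow> \<xi> $ k | _ \<Rightarrow> 0))"

definition a_mat :: "real ^ 'n \<Rightarrow> real ^ ('n::finite) option ^ 'n option" where
  "a_mat \<tau> = (\<chi> i j. if i = j
     then (case i of Some k \<Rightarrow> exp (\<tau> $ k) | None \<Rightarrow> exp (- (\<Sum>k\<in>UNIV. \<tau> $ k)))
     else 0)"

lemma det_a_mat: "det (a_mat \<tau>) = 1"
proof -
  have "det (a_mat \<tau>) = (\<Prod>i\<in>UNIV. a_mat \<tau> $ i $ i)"
    by (rule det_diagonal) (simp add: a_mat_def)
  also have "\<dots> = exp (- (\<Sum>k\<in>UNIV. \<tau> $ k)) * (\<Prod>k\<in>UNIV. exp (\<tau> $ k))"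
    by (simp add: UNIV_option_conv a_mat_def prod.reindex)
  also have "\<dots> = 1"
    by (simp add: exp_sum[symmetric] exp_minus_inverse exp_minus)
  finally show ?thesis .
qed

lemma det_u_mat: "det (u_mat \<xi>) = 1"
proof -
  have only_id: "p = id" if "p permutes (UNIV :: 'a option set)"
      and nz: "\<And>i. u_mat \<xi> $ i $ p i \<noteq> 0" for p
  proof -
    have inj: "inj p" using that(1) permutes_inj by blast
    have N: "p None = None" using nz[of None] by (auto simp: u_mat_def split: if_splits)
    have "p (Some k) = Some k" for k
    proof -
      have "p (Some k) \<noteq> None" using inj N by (metis injD option.distinct(1))
      then show ?thesis using nz[of "Some k"]
        by (auto simp: u_mat_def split: if_splits option.splits)
    qed
    with N show ?thesis by (metis eq_id_iff option.exhaust)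
  qed
  have "det (u_mat \<xi>) = (\<Sum>p\<in>{id}. of_int (sign p) * (\<Prod>i\<in>UNIV. u_mat \<xi> $ i $ p i))"
    unfolding det_def
  proof (rule sum.mono_neutral_right)
    show "\<forall>p\<in>{p. p permutes UNIV} - {id}. of_int (sign p) * (\<Prod>i\<in>UNIV. u_mat \<xi> $ i $ p i) = 0"
    proof
      fix p assume p: "p \<in> {p. p permutes (UNIV :: 'a option set)} - {id}"
      then obtain i where "u_mat \<xi> $ i $ p i = 0" using only_id[of p] by blast
      then show "of_int (sign p) * (\<Prod>i\<in>UNIV. u_mat \<xi> $ i $ p i) = 0"
        by (auto simp: prod_zero_iff)
    qed
  qed (auto simp: permutes_id finite_permutations)
  also have "\<dots> = 1" by (simp add: u_mat_def)
  finally show ?thesis .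
qed


text \<open>
  The left translate \<open>g x\<close> of a coset \<open>x\<close> is \<open>g <#\<^bsub>SL\<^esub> x\<close>, the set of all \<open>g ** h\<close> with \<open>h \<in> x\<close>.
\<close>

definition Aplus_divergent_on_average :: "(real ^ ('n::finite) option ^ 'n option) set \<Rightarrow> bool" where
  "Aplus_divergent_on_average x \<longleftrightarrow> x \<in> topspace quotient_space \<and>
     (\<forall>K. compactin quotient_space K \<longrightarrow>
       (\<lambda>N. 1 / real N ^ CARD('n) *
          real (card {\<tau> :: nat ^ 'n. (\<forall>i. \<tau> $ i \<in> {1..N}) \<and>
                        a_mat (\<chi> i. real (\<tau> $ i)) <#\<^bsub>SL\<^esub> x \<in> K}))
       \<longlonglongrightarrow> 0)"

lemma finite_box: "finite {\<tau> :: nat ^ 'n. (\<forall>i. \<tau> $ i \<in> {1..N}) \<and> P \<tau>}"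
proof (rule finite_subset)
  show "{\<tau> :: nat ^ 'n. (\<forall>i. \<tau> $ i \<in> {1..N}) \<and> P \<tau>} \<subseteq> vec_lambda ` (UNIV \<rightarrow>\<^sub>E {1..N})"
  proof
    fix \<tau> :: "nat ^ 'n" assume "\<tau> \<in> {\<tau>. (\<forall>i. \<tau> $ i \<in> {1..N}) \<and> P \<tau>}"
    then show "\<tau> \<in> vec_lambda ` (UNIV \<rightarrow>\<^sub>E {1..N})"
      by (intro image_eqI[of _ _ "vec_nth \<tau>"]) (auto simp: PiE_def)
  qed
  show "finite ((vec_lambda :: ('n \<Rightarrow> nat) \<Rightarrow> nat ^ 'n) ` (UNIV \<rightarrow>\<^sub>E {1..N}))"
    by (intro finite_imageI finite_PiE) auto
qed

definition rat_scale :: "rat \<Rightarrow> real \<Rightarrow> real" where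
  "rat_scale q x = of_rat q * x"

interpretation rat_real: vector_space rat_scale
  by standard (simp_all add: rat_scale_def algebra_simps of_rat_add of_rat_mult)

definition R_set :: "(real ^ 'n) set" where
  "R_set = {\<xi>. (\<forall>i. \<xi> $ i \<in> {- 1/2 .. 1/2}) \<and>
     rat_real.dim (rat_real.span (insert 1 (range (\<lambda>i. \<xi> $ i)))) \<le> 2}"

end

theory Submission
  imports Defs
begin

text \<open>
  The hypothesis says that all coordinates of \<open>\<xi>\<close> are rational combinations of \<open>1\<close> and a single
  real \<open>\<theta>\<close>: with a common denominator, \<open>D * \<xi>\<^sub>i = a\<^sub>i + b\<^sub>i * \<theta>\<close>. Hence a single
  good rational approximation \<open>n / m\<close> of \<open>\<theta>\<close> approximates all coordinates at once: the integer
  vector with last entry \<open>D * m\<close> and other entries \<open>- m * a\<^sub>i - n * b\<^sub>i\<close> is moved by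
  \<open>u_mat \<xi>\<close> to the vector with entries \<open>b\<^sub>i * (m * \<theta> - n)\<close> and \<open>D * m\<close>. By Dirichlet's
  theorem \<open>\<bar>m * \<theta> - n\<bar> < 1 / M\<close> for some \<open>1 \<le> m \<le> M\<close>. Take \<open>M\<close> to be a large constant
  multiple of \<open>exp T\<close>, where \<open>T\<close> is the largest \<open>\<tau>\<^sub>i\<close>. Then \<open>a_mat \<tau>\<close> keeps the first
  \<open>d - 1\<close> entries small, and it multiplies the last one by \<open>exp (- (\<Sum>i. \<tau>\<^sub>i))\<close>. Since
  \<open>d - 1 \<ge> 2\<close>, the sum exceeds \<open>T\<close> by at least one further \<open>\<tau>\<^sub>j\<close>, so the last entry is small as
  well as soon as all \<open>\<tau>\<^sub>i\<close> exceed a constant \<open>C\<close> (\<open>short_vector_of_large_times\<close>).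

  A compact set of lattices admits a positive lower bound for the lengths of nonzero vectors, the
  easy half of Mahler's criterion (\<open>compact_imp_vectors_bounded_below\<close>). So \<open>a_mat \<tau>\<close> can bring
  the lattice of \<open>u_mat \<xi>\<close> into a given compact set only if some \<open>\<tau>\<^sub>i\<close> is at most \<open>C\<close>.
  There are only \<open>O(N^(d-2))\<close> such \<open>\<tau>\<close> in the box (\<open>card_box_near_face\<close>), out of
  \<open>N^(d-1)\<close>.
\<close>

section \<open>Compact sets of lattices contain no arbitrarily short vectors\<close>

lemma norm_matrix_vector_le:
  fixes A :: "real ^ 'm ^ 'k"
  shows "norm (A *v x) \<le> real CARD('k) * real CARD('m) * norm A * norm x"
proof -
  have "\<bar>A $ i $ j\<bar> \<le> norm A" for i j
    using component_le_norm_cart[of "A $ i" j] Finite_Cartesian_Product.norm_nth_le[of A i]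
    by linarith
  then have "onorm ((*v) A) \<le> real CARD('k) * real CARD('m) * norm A"
    by (rule onorm_le_matrix_component)
  moreover have "norm (A *v x) \<le> onorm ((*v) A) * norm x"
    by (rule onorm) simp
  ultimately show ?thesis
    by (meson mult_right_mono norm_ge_zero order_trans)
qed

lemma invertible_bounded_below:
  fixes A :: "real ^ 'm ^ 'm"
  assumes "det A \<noteq> 0"
  obtains c where "c > 0" "\<And>x. c * norm x \<le> norm (A *v x)"
proof -
  have "inj ((*v) A)"
    using assms by (simp add: invertible_det_nz[symmetric] inj_matrix_vector_mult)
  then show ?thesis
    using linear_inj_bounded_below_pos[of "(*v) A"] that matrix_vector_mul_linear by blast
qed

definition nonzero_int_vec :: "real ^ 'm \<Rightarrow> bool" where
  "nonzero_int_vec v \<longleftrightarrow> v \<noteq> 0 \<and> (\<forall>i. v $ i \<in> \<int>)"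

lemma norm_nonzero_int_vec_ge_1:
  assumes "nonzero_int_vec v"
  shows "1 \<le> norm v"
proof -
  obtain i where "v $ i \<noteq> 0" "v $ i \<in> \<int>"
    using assms by (auto simp: nonzero_int_vec_def vec_eq_iff)
  then have "1 \<le> \<bar>v $ i\<bar>" by (rule Ints_nonzero_abs_ge1[rotated])
  then show ?thesis using component_le_norm_cart[of v i] by linarith
qed

lemma nonzero_int_vec_SL_int:
  assumes "\<gamma> \<in> SL_int" "nonzero_int_vec v"
  shows "nonzero_int_vec (\<gamma> *v v)"
proof -
  obtain c where "c > 0" "\<And>x. c * norm x \<le> norm (\<gamma> *v x)"
    using invertible_bounded_below[of \<gamma>] assms(1) by (auto simp: SL_int_def)
  then have "\<gamma> *v v \<noteq> 0"
    using assms(2) by (metis mult_pos_pos nonzero_int_vec_def norm_zero not_less zero_less_norm_iff)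
  then show ?thesis
    using assms by (auto simp: nonzero_int_vec_def SL_int_def matrix_vector_mult_def
        intro!: Ints_sum Ints_mult)
qed

lemma l_coset_SL_int: "g <#\<^bsub>SL\<^esub> SL_int = (\<lambda>\<gamma>. g ** \<gamma>) ` SL_int"
  by (auto simp: l_coset_def SL_def)

lemma mat_1_in_SL_int: "mat 1 \<in> SL_int"
  using subgroup.one_closed[OF subgroup_SL_int] by (simp add: SL_def)

text \<open>
  The coset \<open>g ** SL_int\<close> stands for the lattice of all \<open>g *v v\<close> with integral \<open>v\<close>. Asking for a
  lower bound \<open>\<epsilon>\<close> that strictly exceeds \<open>\<delta>\<close>, uniformly in the vectors, is what makes the following
  set open.
\<close>

definition vectors_longer :: "real \<Rightarrow> (real ^ 'm ^ 'm) set set" where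
  "vectors_longer \<delta> = {x \<in> lcosets\<^bsub>SL\<^esub> SL_int.
     \<exists>\<epsilon>>\<delta>. \<forall>h\<in>x. \<forall>v. nonzero_int_vec v \<longrightarrow> \<epsilon> \<le> norm (h *v v)}"

lemma l_coset_in_vectors_longer_iff:
  assumes "g \<in> carrier SL"
  shows "g <#\<^bsub>SL\<^esub> SL_int \<in> vectors_longer \<delta> \<longleftrightarrow>
    (\<exists>\<epsilon>>\<delta>. \<forall>v. nonzero_int_vec v \<longrightarrow> \<epsilon> \<le> norm (g *v v))"
proof -
  have "(\<forall>h\<in>g <#\<^bsub>SL\<^esub> SL_int. \<forall>v. nonzero_int_vec v \<longrightarrow> \<epsilon> \<le> norm (h *v v)) \<longleftrightarrow>
      (\<forall>v. nonzero_int_vec v \<longrightarrow> \<epsilon> \<le> norm (g *v v))" for \<epsilon>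
  proof
    assume "\<forall>h\<in>g <#\<^bsub>SL\<^esub> SL_int. \<forall>v. nonzero_int_vec v \<longrightarrow> \<epsilon> \<le> norm (h *v v)"
    moreover have "g \<in> g <#\<^bsub>SL\<^esub> SL_int"
      unfolding l_coset_SL_int using mat_1_in_SL_int by (force intro: image_eqI[of _ _ "mat 1"])
    ultimately show "\<forall>v. nonzero_int_vec v \<longrightarrow> \<epsilon> \<le> norm (g *v v)" by blast
  next
    assume "\<forall>v. nonzero_int_vec v \<longrightarrow> \<epsilon> \<le> norm (g *v v)"
    then show "\<forall>h\<in>g <#\<^bsub>SL\<^esub> SL_int. \<forall>v. nonzero_int_vec v \<longrightarrow> \<epsilon> \<le> norm (h *v v)"
      by (auto simp: l_coset_SL_int nonzero_int_vec_SL_int simp flip: matrix_vector_mul_assoc)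
  qed
  moreover have "g <#\<^bsub>SL\<^esub> SL_int \<in> lcosets\<^bsub>SL\<^esub> SL_int"
    using assms by (auto simp: LCOSETS_def)
  ultimately show ?thesis by (simp add: vectors_longer_def)
qed

text \<open>
  A single invertible \<open>g\<close> satisfies \<open>c * norm x \<le> norm (g *v x)\<close>, so replacing \<open>g\<close> by \<open>g'\<close>
  changes the length of each lattice vector by a relative amount of at most
  \<open>norm (g' - g) * const / c\<close>, which is uniform over the infinitely many vectors of the lattice.
\<close>

lemma openin_vectors_longer:
  assumes "\<delta> > 0"
  shows "openin quotient_space (vectors_longer \<delta> :: (real ^ 'm ^ 'm) set set)"
  unfolding openin_quotient_space
proof
  show "vectors_longer \<delta> \<subseteq> (lcosets\<^bsub>SL\<^esub> SL_int :: (real ^ 'm ^ 'm) set set)"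
    by (auto simp: vectors_longer_def)
  let ?V = "{g \<in> carrier SL. g <#\<^bsub>SL\<^esub> SL_int \<in> vectors_longer \<delta>} :: (real ^ 'm ^ 'm) set"
  show "openin (top_of_set (carrier SL)) ?V"
    unfolding openin_euclidean_subtopology_iff
  proof (intro conjI ballI)
    show "?V \<subseteq> carrier SL" by blast
    fix g assume "g \<in> ?V"
    then have g: "g \<in> carrier SL" "g <#\<^bsub>SL\<^esub> SL_int \<in> vectors_longer \<delta>" by auto
    then obtain \<epsilon> where \<epsilon>: "\<epsilon> > \<delta>" "\<And>v. nonzero_int_vec v \<Longrightarrow> \<epsilon> \<le> norm (g *v v)"
      by (auto simp: l_coset_in_vectors_longer_iff)
    obtain c where c: "c > 0" "\<And>x. c * norm x \<le> norm (g *v x)"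
      using invertible_bounded_below[of g] g(1) by (auto simp: SL_def)
    define k where "k = real CARD('m) * real CARD('m)"
    have k: "k > 0" by (simp add: k_def)
    \<comment> \<open>\<open>\<epsilon> * (1 - s)\<close> is the midpoint of \<open>\<delta>\<close> and \<open>\<epsilon>\<close>.\<close>
    define s where "s = (\<epsilon> - \<delta>) / (2 * \<epsilon>)"
    have s: "0 < s" "s < 1" "\<delta> < \<epsilon> * (1 - s)"
      using \<epsilon>(1) assms by (auto simp: s_def field_simps)
    show "\<exists>e>0. \<forall>g'\<in>carrier SL. dist g' g < e \<longrightarrow> g' \<in> ?V"
    proof (intro exI[of _ "s * c / k"] conjI ballI impI)
      show "s * c / k > 0" using s c(1) k by simp
      fix g' :: "real ^ 'm ^ 'm" assume g': "g' \<in> carrier SL" "dist g' g < s * c / k"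
      have "\<epsilon> * (1 - s) \<le> norm (g' *v v)" if v: "nonzero_int_vec v" for v
      proof -
        have "norm ((g' - g) *v v) \<le> k * norm (g' - g) * norm v"
          using norm_matrix_vector_le[of "g' - g" v] by (simp add: k_def)
        also have "\<dots> \<le> s * c * norm v"
          using g'(2) k by (intro mult_right_mono) (auto simp: dist_norm field_simps)
        also have "\<dots> \<le> s * norm (g *v v)"
          using c(2)[of v] s(1) by (simp add: mult.assoc)
        finally have "norm (g' *v v - g *v v) \<le> s * norm (g *v v)"
          by (simp add: matrix_vector_mult_diff_rdistrib)
        moreover have "norm (g *v v) - norm (g' *v v) \<le> norm (g' *v v - g *v v)"
          by (metis norm_minus_commute norm_triangle_ineq2)
        ultimately have "norm (g *v v) * (1 - s) \<le> norm (g' *v v)"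
          by (simp add: algebra_simps)
        moreover have "\<epsilon> * (1 - s) \<le> norm (g *v v) * (1 - s)"
          using \<epsilon>(2)[OF v] s(2) by (intro mult_right_mono) auto
        ultimately show ?thesis by linarith
      qed
      then show "g' \<in> ?V"
        using g'(1) s(3) by (auto simp: l_coset_in_vectors_longer_iff)
    qed
  qed
qed

lemma ex_vectors_longer:
  assumes "x \<in> lcosets\<^bsub>SL\<^esub> SL_int"
  shows "\<exists>k. x \<in> vectors_longer (1 / real (Suc k))"
proof -
  obtain g where g: "g \<in> carrier SL" "x = g <#\<^bsub>SL\<^esub> SL_int"
    using assms by (auto simp: LCOSETS_def)
  obtain c where c: "c > 0" "\<And>x. c * norm x \<le> norm (g *v x)"
    using invertible_bounded_below[of g] g(1) by (auto simp: SL_def)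
  obtain k where k: "1 / real (Suc k) < c"
    using c(1) nat_approx_posE by blast
  have "c \<le> norm (g *v v)" if "nonzero_int_vec v" for v
    using norm_nonzero_int_vec_ge_1[OF that] c(2)[of v] c(1)
      mult_left_mono[of 1 "norm v" c] by linarith
  then show ?thesis
    using g k by (auto simp: l_coset_in_vectors_longer_iff)
qed

text \<open>
  The open sets \<open>vectors_longer (1 / Suc k)\<close> increase with \<open>k\<close> and cover the whole space, so one
  of them contains the given compact set.
\<close>

lemma compact_imp_vectors_bounded_below:
  assumes "compactin quotient_space (K :: (real ^ 'm ^ 'm) set set)"
  obtains \<epsilon> where "\<epsilon> > 0"
    "\<And>h v. h \<in> \<Union>K \<Longrightarrow> nonzero_int_vec v \<Longrightarrow> \<epsilon> \<le> norm (h *v v)"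
proof -
  let ?W = "\<lambda>k. vectors_longer (1 / real (Suc k)) :: (real ^ 'm ^ 'm) set set"
  have "K \<subseteq> \<Union>(range ?W)"
    using compactin_subset_topspace[OF assms] ex_vectors_longer
    by (force simp: topspace_quotient_space)
  moreover have "openin quotient_space U" if "U \<in> range ?W" for U
    using that by (auto intro: openin_vectors_longer)
  ultimately obtain F where F: "finite F" "F \<subseteq> range ?W" "K \<subseteq> \<Union>F"
    using compactinD[OF assms, of "range ?W"] by metis
  obtain J where J: "finite J" "F = ?W ` J"
    using F(1,2) by (metis finite_subset_image)
  define k where "k = Max (insert 0 J)"
  show ?thesis
  proof (rule that[of "1 / real (Suc k)"])
    show "1 / real (Suc k) > 0" by simp
    fix h :: "real ^ 'm ^ 'm" and v :: "real ^ 'm" assume h: "h \<in> \<Union>K" and v: "nonzero_int_vec v"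
    obtain j where j: "j \<in> J" "h \<in> \<Union>(?W j)" using h F(3) J(2) by blast
    have "j \<le> k" using J(1) j(1) by (simp add: k_def)
    then have "1 / real (Suc k) \<le> 1 / real (Suc j)" by (simp add: frac_le)
    also have "\<dots> \<le> norm (h *v v)" using j(2) v by (force simp: vectors_longer_def)
    finally show "1 / real (Suc k) \<le> norm (h *v v)" .
  qed
qed

section \<open>Coordinates spanning a plane over the rationals\<close>

text \<open>
  Extending the independent set \<open>{1}\<close>, rather than taking any basis of the span, guarantees that
  \<open>1\<close> is among the at most two basis vectors. The real \<open>\<theta>\<close> may be rational when the dimension is \<open>1\<close>.
\<close>

lemma rat_dim_le_2_imp_combinations:
  assumes "rat_real.dim S \<le> 2" "finite S" "1 \<in> S"
  obtains \<theta> where "\<And>x. x \<in> S \<Longrightarrow> \<exists>p q. x = of_rat p + of_rat q * \<theta>"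
proof -
  have "rat_real.independent {1}"
    by simp
  then obtain B where B: "{1} \<subseteq> B" "B \<subseteq> S" "rat_real.independent B" "S \<subseteq> rat_real.span B"
    using rat_real.maximal_independent_subset_extend[of "{1}" S] assms(3) by blast
  have "finite B" using B(2) assms(2) finite_subset by blast
  have "card B \<le> 2" using rat_real.basis_card_eq_dim[OF B(2,4,3)] assms(1) by simp
  then have "card (B - {1}) \<le> 1" using \<open>finite B\<close> B(1) by simp
  then obtain \<theta> where "B - {1} \<subseteq> {\<theta>}"
    using \<open>finite B\<close> by (metis card_le_Suc0_iff_eq One_nat_def finite_Diff insertI1 subsetI
        empty_subsetI ex_in_conv)
  then have "S \<subseteq> rat_real.span {1, \<theta>}"
    using B(4) rat_real.span_mono[of B "{1, \<theta>}"] by blast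
  then have "\<exists>p q. x = of_rat p + of_rat q * \<theta>" if "x \<in> S" for x
    using that unfolding rat_real.span_insert rat_real.span_empty
    by (force simp: rat_scale_def algebra_simps)
  then show ?thesis by (rule that)
qed

lemma finite_common_denominator:
  assumes "finite (Q :: rat set)"
  obtains D :: nat where "D > 0" "\<And>q. q \<in> Q \<Longrightarrow> of_nat D * q \<in> \<int>"
  using assms
proof (induction Q arbitrary: thesis)
  case empty
  then show ?case by (metis empty_iff zero_less_one)
next
  case (insert r Q)
  obtain D :: nat where D: "D > 0" "\<And>q. q \<in> Q \<Longrightarrow> of_nat D * q \<in> \<int>" using insert.IH by blast
  obtain a b where ab: "quotient_of r = (a, b)" by fastforce
  then have b: "b > 0" "r = of_int a / of_int b"
    using quotient_of_denom_pos quotient_of_div by blast+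
  show ?case
  proof (rule insert.prems[of "D * nat b"])
    show "D * nat b > 0" using D(1) b(1) by simp
    fix q assume "q \<in> insert r Q"
    then consider "q = r" | "q \<in> Q" by blast
    then show "of_nat (D * nat b) * q \<in> \<int>"
    proof cases
      case 1
      then have "of_nat (D * nat b) * q = of_int (int D * a)" using b by simp
      then show ?thesis by (metis Ints_of_int)
    next
      case 2
      have "of_nat (D * nat b) * q = of_nat (nat b) * (of_nat D * q)" by simp
      then show ?thesis using D(2)[OF 2] by (metis Ints_mult Ints_of_nat)
    qed
  qed
qed

lemma R_set_affine_coordinates:
  fixes \<xi> :: "real ^ ('n::finite)"
  assumes "\<xi> \<in> R_set"
  obtains D :: nat and a b :: "'n \<Rightarrow> int" and \<theta> :: real
  where "D > 0" "\<And>i. real D * \<xi> $ i = of_int (a i) + of_int (b i) * \<theta>"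
proof -
  have "rat_real.dim (insert 1 (range (\<lambda>i. \<xi> $ i))) \<le> 2"
    using assms by (simp add: R_set_def rat_real.dim_span)
  then obtain \<theta> where "\<And>x. x \<in> insert 1 (range (\<lambda>i. \<xi> $ i)) \<Longrightarrow> \<exists>p q. x = of_rat p + of_rat q * \<theta>"
    by (rule rat_dim_le_2_imp_combinations) auto
  then have "\<forall>i. \<exists>p q. \<xi> $ i = of_rat p + of_rat q * \<theta>" by blast
  then obtain p q where pq: "\<And>i. \<xi> $ i = of_rat (p i) + of_rat (q i) * \<theta>" by metis
  obtain D :: nat where D: "D > 0" "\<And>r. r \<in> range p \<union> range q \<Longrightarrow> of_nat D * r \<in> \<int>"
    by (rule finite_common_denominator[of "range p \<union> range q"]) auto
  have "\<forall>i. \<exists>c. of_nat D * p i = of_int c" "\<forall>i. \<exists>c. of_nat D * q i = of_int c"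
    using D(2) by (meson Ints_cases UnCI rangeI)+
  then obtain a b where ab: "\<And>i. of_nat D * p i = of_int (a i)" "\<And>i. of_nat D * q i = of_int (b i)"
    by metis
  have "real D * of_rat (p i) = of_int (a i)" "real D * of_rat (q i) = of_int (b i)" for i
    using arg_cong[OF ab(1)[of i], of "of_rat :: rat \<Rightarrow> real"]
      arg_cong[OF ab(2)[of i], of "of_rat :: rat \<Rightarrow> real"]
    by (simp_all add: of_rat_mult)
  then have "real D * \<xi> $ i = of_int (a i) + of_int (b i) * \<theta>" for i
    by (simp add: pq distrib_left mult.assoc[symmetric])
  with D(1) show ?thesis by (rule that)
qed

section \<open>Short vectors for all times far from the walls\<close>

lemma a_u_mat_mult_vec:
  fixes \<xi> :: "real ^ ('n::finite)"
  shows "((a_mat \<tau> ** u_mat \<xi>) *v v) $ Some i = exp (\<tau> $ i) * (v $ Some i + \<xi> $ i * v $ None)"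
    and "((a_mat \<tau> ** u_mat \<xi>) *v v) $ None = exp (- (\<Sum>k\<in>UNIV. \<tau> $ k)) * v $ None"
proof -
  have a: "(a_mat \<tau> *v w) $ j = a_mat \<tau> $ j $ j * w $ j" for w j
    unfolding matrix_vector_mult_def
    by (simp add: a_mat_def if_distrib[of "\<lambda>t. t * _"] cong: if_cong)
  have u: "(u_mat \<xi> *v v) $ Some i = v $ Some i + \<xi> $ i * v $ None"
    "(u_mat \<xi> *v v) $ None = v $ None"
    unfolding matrix_vector_mult_def
    by (simp_all add: u_mat_def UNIV_option_conv sum.reindex if_distrib[of "\<lambda>t. t * _"] cong: if_cong)
  show "((a_mat \<tau> ** u_mat \<xi>) *v v) $ Some i = exp (\<tau> $ i) * (v $ Some i + \<xi> $ i * v $ None)"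
    "((a_mat \<tau> ** u_mat \<xi>) *v v) $ None = exp (- (\<Sum>k\<in>UNIV. \<tau> $ k)) * v $ None"
    unfolding matrix_vector_mul_assoc[symmetric] a u by (simp_all add: a_mat_def)
qed

text \<open>
  This is where at least two coordinates are needed: with \<open>T = \<tau>\<^sub>k\<close> the largest time, the sum
  of all times is at least \<open>T + C\<close> because of any second coordinate.
\<close>

lemma short_vector_of_large_times:
  fixes \<xi> :: "real ^ ('n::finite)"
  assumes D: "D > 0" "\<And>i. real D * \<xi> $ i = of_int (a i) + of_int (b i) * \<theta>"
    and card: "CARD('n) \<ge> 2" and "\<epsilon> > 0"
  obtains C :: nat where
    "\<And>\<tau> :: real ^ 'n. (\<And>i. \<tau> $ i > real C) \<Longrightarrow>
       \<exists>v. nonzero_int_vec v \<and> norm ((a_mat \<tau> ** u_mat \<xi>) *v v) < \<epsilon>"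
proof -
  define \<eta> where "\<eta> = \<epsilon> / real CARD('n option)"
  have \<eta>: "\<eta> > 0" using \<open>\<epsilon> > 0\<close> by (simp add: \<eta>_def)
  define B where "B = 1 + (\<Sum>i\<in>UNIV. \<bar>real_of_int (b i)\<bar>)"
  have B: "B > 0" by (simp add: B_def add_pos_nonneg sum_nonneg)
  have bB: "\<bar>real_of_int (b i)\<bar> \<le> B" for i
    using member_le_sum[of i UNIV "\<lambda>i. \<bar>real_of_int (b i)\<bar>"] by (simp add: B_def)
  define R where "R = B / \<eta> + 1"
  have R: "R > 0" using B \<eta> by (simp add: R_def add_pos_pos)
  obtain C :: nat where C: "ln (real D * R / \<eta>) < real C"
    using reals_Archimedean2 by blast
  show ?thesis
  proof (rule that[of C])
    fix \<tau> :: "real ^ 'n" assume \<tau>: "\<And>i. \<tau> $ i > real C"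
    have "Max (range (\<lambda>i. \<tau> $ i)) \<in> range (\<lambda>i. \<tau> $ i)" by (intro Max_in) auto
    then obtain k where "Max (range (\<lambda>i. \<tau> $ i)) = \<tau> $ k" by blast
    then have k: "\<tau> $ i \<le> \<tau> $ k" for i
      using Max_ge[of "range (\<lambda>i. \<tau> $ i)" "\<tau> $ i"] by simp
    have "UNIV \<noteq> {k}" using card by (metis card.empty card.insert empty_iff finite.emptyI
          Suc_n_not_le_n numeral_2_eq_2)
    then obtain j where j: "j \<noteq> k" by blast
    have "(\<Sum>i\<in>{j, k}. \<tau> $ i) \<le> (\<Sum>i\<in>UNIV. \<tau> $ i)"
      using \<tau> by (intro sum_mono2) (auto intro: less_imp_le order_trans[OF of_nat_0_le_iff])
    then have sum: "\<tau> $ k + real C < (\<Sum>i\<in>UNIV. \<tau> $ i)"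
      using j \<tau>[of j] by simp
    have T: "\<tau> $ k \<ge> 0" using \<tau>[of k] by linarith
    \<comment> \<open>The factor \<open>B / \<eta>\<close> compensates the coefficients \<open>b\<^sub>i\<close> and the required size \<open>\<eta>\<close>.\<close>
    define M where "M = nat \<lceil>B / \<eta> * exp (\<tau> $ k)\<rceil>"
    have M: "B / \<eta> * exp (\<tau> $ k) \<le> real M" "real M \<le> B / \<eta> * exp (\<tau> $ k) + 1"
      using B \<eta> by (auto simp: M_def of_nat_ceiling)
    have M0: "0 < B / \<eta> * exp (\<tau> $ k)" using B \<eta> by simp
    have "real M > 0" using M(1) M0 by linarith
    then have "M > 0" by simp
    have MR: "real M \<le> R * exp (\<tau> $ k)"
      using M(2) T by (simp add: R_def distrib_right add_increasing order_trans)
    obtain h m where hm: "0 < m" "m \<le> int M" "\<bar>of_int m * \<theta> - of_int h\<bar> < 1 / real M"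
      using Dirichlet_approx[OF \<open>M > 0\<close>] by blast
    \<comment> \<open>The terms \<open>m * a\<^sub>i\<close> cancel the part of \<open>D * m * \<xi>\<^sub>i\<close> that is free of \<open>\<theta>\<close>.\<close>
    define v :: "real ^ 'n option" where
      "v = (\<chi> i. case i of Some i \<Rightarrow> of_int (- m * a i - h * b i) | None \<Rightarrow> of_int (int D * m))"
    define w where "w = (a_mat \<tau> ** u_mat \<xi>) *v v"
    have vN: "v $ None \<noteq> 0" using D(1) hm(1) by (simp add: v_def)
    have "v $ i \<in> \<int>" for i unfolding v_def by (cases i) auto
    with vN have v: "nonzero_int_vec v" by (auto simp: nonzero_int_vec_def)
    have "\<bar>w $ Some i\<bar> < \<eta>" for i
    proof -
      have "v $ Some i + \<xi> $ i * v $ None = of_int m * (real D * \<xi> $ i - of_int (a i)) - of_int (h * b i)"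
        by (simp add: v_def algebra_simps)
      also have "\<dots> = of_int (b i) * (of_int m * \<theta> - of_int h)"
        unfolding D(2) by (simp add: algebra_simps)
      finally have "\<bar>w $ Some i\<bar> = exp (\<tau> $ i) * (\<bar>of_int (b i)\<bar> * \<bar>of_int m * \<theta> - of_int h\<bar>)"
        by (simp add: w_def a_u_mat_mult_vec abs_mult)
      also have "\<dots> \<le> exp (\<tau> $ k) * (B * \<bar>of_int m * \<theta> - of_int h\<bar>)"
        using k[of i] bB[of i] by (intro mult_mono) auto
      also have "\<dots> < exp (\<tau> $ k) * (B * (1 / real M))"
        using hm(3) B by (intro mult_strict_left_mono) auto
      also have "\<dots> \<le> \<eta>"
        using M(1) \<eta> \<open>real M > 0\<close> by (simp add: field_simps)
      finally show ?thesis .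
    qed
    moreover have "\<bar>w $ None\<bar> < \<eta>"
    proof -
      have "\<bar>w $ None\<bar> = exp (- (\<Sum>i\<in>UNIV. \<tau> $ i)) * (real D * of_int m)"
        using hm(1) by (simp add: w_def a_u_mat_mult_vec v_def abs_mult)
      also have "\<dots> \<le> exp (- (\<tau> $ k + real C)) * (real D * (R * exp (\<tau> $ k)))"
        using sum MR hm(1,2) by (intro mult_mono) auto
      also have "\<dots> = real D * R * exp (- real C)"
        by (simp add: exp_diff exp_minus field_simps)
      also have "\<dots> < \<eta>"
      proof -
        have "real D * R / \<eta> < exp (real C)"
          using C D(1) R \<eta> by (metis divide_pos_pos exp_less_mono exp_ln mult_pos_pos of_nat_0_less_iff)
        then show ?thesis using \<eta> by (simp add: exp_minus field_simps)
      qed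
      finally show ?thesis .
    qed
    ultimately have "\<bar>w $ i\<bar> < \<eta>" for i by (cases i) auto
    then have "(\<Sum>i\<in>UNIV. \<bar>w $ i\<bar>) < (\<Sum>i\<in>(UNIV :: 'n option set). \<eta>)"
      by (intro sum_strict_mono) auto
    then have "norm w < \<epsilon>"
      using norm_le_l1_cart[of w] by (simp add: \<eta>_def)
    with v show "\<exists>v. nonzero_int_vec v \<and> norm ((a_mat \<tau> ** u_mat \<xi>) *v v) < \<epsilon>"
      unfolding w_def by blast
  qed
qed

section \<open>Counting\<close>

text \<open>
  For each index \<open>i\<close>, the points with \<open>\<tau>\<^sub>i \<le> C\<close> form a slab with \<open>C\<close> choices for \<open>\<tau>\<^sub>i\<close> and
  \<open>N\<close> for every other coordinate.
\<close>

lemma card_box_near_face: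
  "card {\<tau> :: nat ^ 'n. (\<forall>i. \<tau> $ i \<in> {1..N}) \<and> (\<exists>i. \<tau> $ i \<le> C)}
     \<le> CARD('n) * (C * N ^ (CARD('n) - 1))"
proof -
  let ?S = "\<lambda>i. vec_lambda ` (\<Pi>\<^sub>E j\<in>UNIV. if j = i then {1..C} else {1..N}) :: (nat ^ 'n) set"
  have fin: "finite (\<Pi>\<^sub>E j\<in>(UNIV :: 'n set). if j = i then {1..C} else {1..N})" for i
    by (intro finite_PiE) auto
  have "card (?S i) \<le> C * N ^ (CARD('n) - 1)" for i
  proof -
    have "card (?S i) \<le> card (\<Pi>\<^sub>E j\<in>(UNIV :: 'n set). if j = i then {1..C} else {1..N})"
      by (rule card_image_le[OF fin])
    also have "\<dots> = (\<Prod>j\<in>(UNIV :: 'n set). if j = i then C else N)"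
      by (simp add: card_PiE if_distrib cong: if_cong)
    also have "\<dots> = C * N ^ (CARD('n) - 1)"
      by (subst prod.remove[of _ i]) (simp_all add: card_Diff_singleton)
    finally show ?thesis .
  qed
  then have "(\<Sum>i\<in>UNIV. card (?S i)) \<le> CARD('n) * (C * N ^ (CARD('n) - 1))"
    using sum_mono[of UNIV "\<lambda>i. card (?S i)" "\<lambda>_. C * N ^ (CARD('n) - 1)"] by simp
  moreover have "{\<tau> :: nat ^ 'n. (\<forall>i. \<tau> $ i \<in> {1..N}) \<and> (\<exists>i. \<tau> $ i \<le> C)} \<subseteq> (\<Union>i. ?S i)"
  proof
    fix \<tau> :: "nat ^ 'n" assume "\<tau> \<in> {\<tau>. (\<forall>i. \<tau> $ i \<in> {1..N}) \<and> (\<exists>i. \<tau> $ i \<le> C)}"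
    then obtain i where i: "\<tau> $ i \<le> C" "\<And>j. \<tau> $ j \<in> {1..N}" by blast
    have "\<tau> \<in> ?S i"
      using i by (intro image_eqI[of _ _ "vec_nth \<tau>"]) (auto simp: PiE_def Pi_def)
    then show "\<tau> \<in> (\<Union>i. ?S i)" by blast
  qed
  then have "card {\<tau> :: nat ^ 'n. (\<forall>i. \<tau> $ i \<in> {1..N}) \<and> (\<exists>i. \<tau> $ i \<le> C)} \<le> card (\<Union>i. ?S i)"
    using fin by (intro card_mono) auto
  moreover have "card (\<Union>i. ?S i) \<le> (\<Sum>i\<in>UNIV. card (?S i))"
    by (rule card_UN_le) simp
  ultimately show ?thesis by linarith
qed

theorem theorem1p4:
  fixes \<xi> :: "real ^ ('n::finite)"
  assumes "CARD('n option) \<ge> 3"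
    and "\<xi> \<in> R_set"
  shows "Aplus_divergent_on_average (u_mat \<xi> <#\<^bsub>SL\<^esub> SL_int)"
  unfolding Aplus_divergent_on_average_def
proof (intro conjI allI impI)
  have n: "CARD('n) \<ge> 2" using assms(1) by (simp add: card_UNIV_option)
  show "u_mat \<xi> <#\<^bsub>SL\<^esub> SL_int \<in> topspace quotient_space"
  proof -
    have "u_mat \<xi> \<in> carrier SL" by (simp add: SL_def det_u_mat)
    then show ?thesis by (auto simp: topspace_quotient_space LCOSETS_def)
  qed
  obtain D a b \<theta> where \<xi>: "D > 0" "\<And>i. real D * \<xi> $ i = of_int (a i) + of_int (b i) * \<theta>"
    using R_set_affine_coordinates[OF assms(2)] by metis
  fix K :: "(real ^ 'n option ^ 'n option) set set"
  assume "compactin quotient_space K"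
  then obtain \<epsilon> where \<epsilon>: "\<epsilon> > 0"
    "\<And>h v. h \<in> \<Union>K \<Longrightarrow> nonzero_int_vec v \<Longrightarrow> \<epsilon> \<le> norm (h *v v)"
    using compact_imp_vectors_bounded_below by metis
  obtain C :: nat where C: "\<And>\<tau> :: real ^ 'n. (\<And>i. \<tau> $ i > real C) \<Longrightarrow>
       \<exists>v. nonzero_int_vec v \<and> norm ((a_mat \<tau> ** u_mat \<xi>) *v v) < \<epsilon>"
    using short_vector_of_large_times[OF \<xi> n \<epsilon>(1)] by blast
  let ?A = "\<lambda>N. {\<tau> :: nat ^ 'n. (\<forall>i. \<tau> $ i \<in> {1..N}) \<and>
      a_mat (\<chi> i. real (\<tau> $ i)) <#\<^bsub>SL\<^esub> (u_mat \<xi> <#\<^bsub>SL\<^esub> SL_int) \<in> K}"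
  have near_face: "\<exists>i. \<tau> $ i \<le> C"
    if \<tau>: "a_mat (\<chi> i. real (\<tau> $ i)) <#\<^bsub>SL\<^esub> (u_mat \<xi> <#\<^bsub>SL\<^esub> SL_int) \<in> K" for \<tau> :: "nat ^ 'n"
  proof (rule ccontr)
    let ?h = "a_mat (\<chi> i. real (\<tau> $ i)) ** u_mat \<xi>"
    assume "\<not> (\<exists>i. \<tau> $ i \<le> C)"
    then obtain v where v: "nonzero_int_vec v" "norm (?h *v v) < \<epsilon>"
      using C[of "\<chi> i. real (\<tau> $ i)"] by (force simp: not_le)
    have "u_mat \<xi> \<in> u_mat \<xi> <#\<^bsub>SL\<^esub> SL_int"
      unfolding l_coset_SL_int using mat_1_in_SL_int by (force intro: image_eqI[of _ _ "mat 1"])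
    then have "?h \<in> a_mat (\<chi> i. real (\<tau> $ i)) <#\<^bsub>SL\<^esub> (u_mat \<xi> <#\<^bsub>SL\<^esub> SL_int)"
      unfolding l_coset_def[of _ "a_mat _"] by (auto simp: SL_def)
    then show False using \<epsilon>(2)[of ?h v] v \<tau> by fastforce
  qed
  have bound: "1 / real N ^ CARD('n) * real (card (?A N)) \<le> real (CARD('n) * C) / real N"
    if "N > 0" for N
  proof -
    have "card (?A N) \<le> card {\<tau> :: nat ^ 'n. (\<forall>i. \<tau> $ i \<in> {1..N}) \<and> (\<exists>i. \<tau> $ i \<le> C)}"
      using near_face by (intro card_mono[OF finite_box]) blast
    then have "card (?A N) \<le> CARD('n) * (C * N ^ (CARD('n) - 1))"
      using card_box_near_face order_trans by blast
    then have "real (card (?A N)) \<le> real (CARD('n) * C) * real N ^ (CARD('n) - 1)"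
      by (simp flip: of_nat_power of_nat_mult add: mult.assoc)
    moreover have "real N ^ CARD('n) = real N * real N ^ (CARD('n) - 1)"
      by (metis power_minus_mult mult.commute zero_less_card_finite)
    ultimately show ?thesis using that by (simp add: field_simps)
  qed
  show "(\<lambda>N. 1 / real N ^ CARD('n) * real (card (?A N))) \<longlonglongrightarrow> 0"
  proof (rule tendsto_sandwich[OF _ _ tendsto_const lim_const_over_n])
    show "\<forall>\<^sub>F N in sequentially. 0 \<le> 1 / real N ^ CARD('n) * real (card (?A N))" by simp
    show "\<forall>\<^sub>F N in sequentially. 1 / real N ^ CARD('n) * real (card (?A N))
        \<le> real (CARD('n) * C) / real N"
      using eventually_gt_at_top[of 0] by eventually_elim (rule bound)
  qed
qed

end
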